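(* Let $(Y,\tau)$ be a topological space and $(Z,\mathcal{U})$ a uniform space. A topology $\mathfrak{T}$ on $EC(Y,Z)$ is admissible if and only if for each net $\{f_n\}_{n\in\Delta}$ in $EC(Y,Z)$ and each $f\in EC(Y,Z)$, convergence of $\{f_n\}_{n\in\Delta}$ to $f$ in $(EC(Y,Z),\mathfrak{T})$ implies equi-continuous convergence of $\{f_n\}_{n\in\Delta}$ to $f$.
   Context: Uniform spaces $(Z,\mathcal{U})$ are given in the usual sense by a family $\mathcal{U}$ of entourages on a non-empty set $Z$. For $U\in\mathcal{U}$ and $z\in Z$, $U[z]=\{w\in Z : (z,w)\in U\}$. Equi-continuity: a function $f:(X,\tau)\to(Z,\mathcal{U})$ from a topological space to a uniform space is equi-continuous at $x\in X$ if for each $U\in\mathcal{U}$ there is an open neighbourhood $V$ of $x$ with $f(V)\subseteq U[f(x)]$; it is equi-continuous if this holds at all $x\in X$. $EC(Y,Z)$ is the set of all equi-continuous functions from $Y$ to $Z$. Net convergence in a uniform space: a net $\{z_n\}_{n\in D}$ in $(Z,\mathcal{U})$ converges to $z$ if for each $U\in\mathcal{U}$ there is $m\in D$ with $(z,z_n)\in U$ for all $n\ge m$. Equi-continuous convergence: a net $\{f_n\}_{n\in\Delta}$ in $EC(Y,Z)$ equi-continuously converges to $f\in EC(Y,Z)$ if for each net $\{y_m\}_{m\in\sigma}$ in $Y$ converging to a point $y\in Y$, the net $\{f_n(y_m)\}_{(n,m)\in\Delta\times\sigma}$ (indexed by the product directed set) converges to $f(y)$ in $Z$. Admissible: a topology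 $\mathfrak{T}$ on $EC(Y,Z)$ is admissible if the evaluation map $e:EC(Y,Z)\times Y\to Z$, $e(f,y)=f(y)$, is equi-continuous (where $EC(Y,Z)\times Y$ has the product topology of $\mathfrak{T}$ and $\tau$). *)

theory Defs
  imports "HOL-Analysis.Analysis"
begin

definition entourage_family :: "'z set \<Rightarrow> ('z \<times> 'z) set set \<Rightarrow> bool" where
  "entourage_family Z \<U> \<longleftrightarrow>
     Z \<noteq> {} \<and> \<U> \<noteq> {} \<and>
     (\<forall>U\<in>\<U>. U \<subseteq> Z \<times> Z \<and> Id_on Z \<subseteq> U) \<and>
     (\<forall>U\<in>\<U>. U\<inverse> \<in> \<U>) \<and>
     (\<forall>U\<in>\<U>. \<exists>V\<in>\<U>. V O V \<subseteq> U) \<and>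
     (\<forall>U\<in>\<U>. \<forall>V\<in>\<U>. U \<inter> V \<in> \<U>) \<and>
     (\<forall>U\<in>\<U>. \<forall>V. U \<subseteq> V \<and> V \<subseteq> Z \<times> Z \<longrightarrow> V \<in> \<U>)"

text \<open>For \<open>U \<subseteq> Z \<times> Z\<close>, the set \<open>U[z]\<close> is the relational image \<open>U `` {z}\<close>.\<close>

definition equicontinuous_at ::
    "'x topology \<Rightarrow> ('z \<times> 'z) set set \<Rightarrow> ('x \<Rightarrow> 'z) \<Rightarrow> 'x \<Rightarrow> bool" where
  "equicontinuous_at X \<U> f x \<longleftrightarrow>
     (\<forall>U\<in>\<U>. \<exists>V. openin X V \<and> x \<in> V \<and> f ` V \<subseteq> U `` {f x})"

definition equicontinuous ::
    "'x topology \<Rightarrow> 'z set \<Rightarrow> ('z \<times> 'z) set set \<Rightarrow> ('x \<Rightarrow> 'z) \<Rightarrow> bool" where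
  "equicontinuous X Z \<U> f \<longleftrightarrow>
     f \<in> topspace X \<rightarrow> Z \<and> (\<forall>x\<in>topspace X. equicontinuous_at X \<U> f x)"

text \<open>Functions on the carrier of \<open>Y\<close> are represented by their extensional versions, so that
  elements of \<open>EC\<close> correspond one-to-one to functions from \<open>Y\<close> to \<open>Z\<close>.\<close>

definition EC :: "'y topology \<Rightarrow> 'z set \<Rightarrow> ('z \<times> 'z) set set \<Rightarrow> ('y \<Rightarrow> 'z) set" where
  "EC Y Z \<U> = {f \<in> topspace Y \<rightarrow>\<^sub>E Z. equicontinuous Y Z \<U> f}"

text \<open>\<open>(m, n) \<in> r\<close> is read as \<open>n \<ge> m\<close>.\<close>

definition directed_set :: "'d set \<Rightarrow> 'd rel \<Rightarrow> bool" where
  "directed_set D r \<longleftrightarrow>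
     D \<noteq> {} \<and> preorder_on D r \<and> (\<forall>a\<in>D. \<forall>b\<in>D. \<exists>c\<in>D. (a, c) \<in> r \<and> (b, c) \<in> r)"

definition prod_order :: "'d rel \<Rightarrow> 'e rel \<Rightarrow> ('d \<times> 'e) rel" where
  "prod_order r s = {((a, b), (a', b')). (a, a') \<in> r \<and> (b, b') \<in> s}"

definition net_in :: "'d set \<Rightarrow> 'd rel \<Rightarrow> ('d \<Rightarrow> 'x) \<Rightarrow> 'x set \<Rightarrow> bool" where
  "net_in D r x X \<longleftrightarrow> directed_set D r \<and> x \<in> D \<rightarrow> X"

definition net_converges ::
    "'x topology \<Rightarrow> 'd set \<Rightarrow> 'd rel \<Rightarrow> ('d \<Rightarrow> 'x) \<Rightarrow> 'x \<Rightarrow> bool" where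
  "net_converges X D r x l \<longleftrightarrow>
     l \<in> topspace X \<and>
     (\<forall>V. openin X V \<and> l \<in> V \<longrightarrow> (\<exists>m\<in>D. \<forall>n\<in>D. (m, n) \<in> r \<longrightarrow> x n \<in> V))"

definition unif_net_converges ::
    "'z set \<Rightarrow> ('z \<times> 'z) set set \<Rightarrow> 'd set \<Rightarrow> 'd rel \<Rightarrow> ('d \<Rightarrow> 'z) \<Rightarrow> 'z \<Rightarrow> bool" where
  "unif_net_converges Z \<U> D r z l \<longleftrightarrow>
     l \<in> Z \<and> (\<forall>U\<in>\<U>. \<exists>m\<in>D. \<forall>n\<in>D. (m, n) \<in> r \<longrightarrow> (l, z n) \<in> U)"

text \<open>HOL cannot quantify over types inside a formula, so the type \<open>'s\<close> from which the index
  sets of the nets in \<open>Y\<close> are drawn is an explicit parameter.\<close>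

definition equicont_converges ::
    "'s itself \<Rightarrow> 'y topology \<Rightarrow> 'z set \<Rightarrow> ('z \<times> 'z) set set \<Rightarrow>
     'd set \<Rightarrow> 'd rel \<Rightarrow> ('d \<Rightarrow> 'y \<Rightarrow> 'z) \<Rightarrow> ('y \<Rightarrow> 'z) \<Rightarrow> bool" where
  "equicont_converges (t :: 's itself) Y Z \<U> D r F f \<longleftrightarrow>
     (\<forall>(S :: 's set) s y l.
        net_in S s y (topspace Y) \<and> net_converges Y S s y l \<longrightarrow>
        unif_net_converges Z \<U> (D \<times> S) (prod_order r s) (\<lambda>(n, m). F n (y m)) (f l))"

definition admissible ::
    "'y topology \<Rightarrow> 'z set \<Rightarrow> ('z \<times> 'z) set set \<Rightarrow> ('y \<Rightarrow> 'z) topology \<Rightarrow> bool" where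
  "admissible Y Z \<U> T \<longleftrightarrow> equicontinuous (prod_topology T Y) Z \<U> (\<lambda>(f, y). f y)"

end

theory Submission
  imports Defs
begin

text \<open>Admissibility is joint continuity of the evaluation map, and a map on a product space is
  continuous at \<open>(a, b)\<close> iff it sends double nets \<open>(x\<^sub>n, y\<^sub>m)\<close> with \<open>x\<^sub>n\<close> converging to \<open>a\<close> and \<open>y\<^sub>m\<close>
  to \<open>b\<close> to convergent nets. If continuity fails for an entourage \<open>U\<close>, pick a bad point from every
  basic neighbourhood \<open>A \<times> B\<close> of \<open>(a, b)\<close>. The coordinates of these points are nets converging to \<open>a\<close>
  and \<open>b\<close>, but the values along the diagonal of their double net never enter the \<open>U\<close>-neighbourhood
  of the limit.\<close>

definition open_nhds :: "'x topology \<Rightarrow> 'x \<Rightarrow> 'x set set" where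
  "open_nhds X x = {V. openin X V \<and> x \<in> V}"

definition nhds_order :: "'x topology \<Rightarrow> 'x \<Rightarrow> 'x set rel" where
  "nhds_order X x = {(V, W) \<in> open_nhds X x \<times> open_nhds X x. W \<subseteq> V}"

lemma topspace_in_open_nhds: "x \<in> topspace X \<Longrightarrow> topspace X \<in> open_nhds X x"
  by (simp add: open_nhds_def)

lemma Int_in_open_nhds: "V \<in> open_nhds X x \<Longrightarrow> W \<in> open_nhds X x \<Longrightarrow> V \<inter> W \<in> open_nhds X x"
  by (auto simp: open_nhds_def)

lemma Times_in_open_nhds:
  "A \<in> open_nhds X a \<Longrightarrow> B \<in> open_nhds Y b \<Longrightarrow> A \<times> B \<in> open_nhds (prod_topology X Y) (a, b)"
  by (auto simp: open_nhds_def openin_prod_Times_iff)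

lemma open_nhds_prod_topologyE:
  assumes "W \<in> open_nhds (prod_topology X Y) (a, b)"
  obtains A B where "A \<in> open_nhds X a" "B \<in> open_nhds Y b" "A \<times> B \<subseteq> W"
  using assms unfolding open_nhds_def openin_prod_topology_alt by blast

lemma directed_set_open_nhds:
  assumes "x \<in> topspace X"
  shows "directed_set (open_nhds X x) (nhds_order X x)"
proof -
  have "\<exists>U\<in>open_nhds X x. (V, U) \<in> nhds_order X x \<and> (W, U) \<in> nhds_order X x"
    if "V \<in> open_nhds X x" "W \<in> open_nhds X x" for V W
    using that Int_in_open_nhds[OF that] by (intro bexI[of _ "V \<inter> W"]) (auto simp: nhds_order_def)
  moreover have "preorder_on (open_nhds X x) (nhds_order X x)"
    by (auto simp: preorder_on_def refl_on_def trans_def nhds_order_def)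
  ultimately show ?thesis
    using topspace_in_open_nhds[OF assms] by (auto simp: directed_set_def)
qed

lemma directed_set_Times:
  assumes D: "directed_set D r" and E: "directed_set E s"
  shows "directed_set (D \<times> E) (prod_order r s)"
proof -
  have "preorder_on (D \<times> E) (prod_order r s)"
    using assms unfolding directed_set_def preorder_on_def
    by (auto simp: prod_order_def refl_on_def intro!: transI dest: transD)
  moreover have "\<exists>p\<in>D \<times> E. ((a, b), p) \<in> prod_order r s \<and> ((a', b'), p) \<in> prod_order r s"
    if "a \<in> D" "a' \<in> D" "b \<in> E" "b' \<in> E" for a a' b b'
  proof -
    obtain c where "c \<in> D" "(a, c) \<in> r" "(a', c) \<in> r"
      using D \<open>a \<in> D\<close> \<open>a' \<in> D\<close> unfolding directed_set_def by blast
    moreover obtain d where "d \<in> E" "(b, d) \<in> s" "(b', d) \<in> s"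
      using E \<open>b \<in> E\<close> \<open>b' \<in> E\<close> unfolding directed_set_def by blast
    ultimately show ?thesis
      by (intro bexI[of _ "(c, d)"]) (simp_all add: prod_order_def)
  qed
  ultimately show ?thesis
    using D E unfolding directed_set_def by auto
qed

lemma net_convergesE:
  assumes "net_converges X D r x l" and "V \<in> open_nhds X l"
  obtains m where "m \<in> D" "\<And>n. n \<in> D \<Longrightarrow> (m, n) \<in> r \<Longrightarrow> x n \<in> V"
  using assms unfolding net_converges_def open_nhds_def by blast

lemma net_convergesI:
  assumes "l \<in> topspace X"
    and "\<And>V. V \<in> open_nhds X l \<Longrightarrow> \<exists>m\<in>D. \<forall>n\<in>D. (m, n) \<in> r \<longrightarrow> x n \<in> V"
  shows "net_converges X D r x l"
  using assms by (simp add: net_converges_def open_nhds_def)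

lemma net_converges_nhds_base_selection:
  assumes "l \<in> topspace X"
    and base: "\<And>V. V \<in> open_nhds X l \<Longrightarrow> \<exists>m\<in>D. N m \<subseteq> V"
    and antimono: "\<And>m n. (m, n) \<in> r \<Longrightarrow> N n \<subseteq> N m"
    and selection: "\<And>n. n \<in> D \<Longrightarrow> x n \<in> N n"
  shows "net_converges X D r x l"
proof (rule net_convergesI)
  fix V assume "V \<in> open_nhds X l"
  then obtain m where "m \<in> D" "N m \<subseteq> V"
    using base by blast
  then show "\<exists>m\<in>D. \<forall>n\<in>D. (m, n) \<in> r \<longrightarrow> x n \<in> V"
    using antimono selection by blast
qed (fact assms(1))

lemma net_converges_continuous_map:
  assumes f: "continuous_map X Y f" and x: "net_converges X D r x l"
  shows "net_converges Y D r (\<lambda>n. f (x n)) (f l)"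
proof (rule net_convergesI)
  have l: "l \<in> topspace X"
    using x by (simp add: net_converges_def)
  then show "f l \<in> topspace Y"
    using continuous_map_image_subset_topspace[OF f] by blast
  fix V assume "V \<in> open_nhds Y (f l)"
  then have "{z \<in> topspace X. f z \<in> V} \<in> open_nhds X l"
    using openin_continuous_map_preimage[OF f] l by (simp add: open_nhds_def)
  then obtain m where "m \<in> D" "\<And>n. n \<in> D \<Longrightarrow> (m, n) \<in> r \<Longrightarrow> x n \<in> {z \<in> topspace X. f z \<in> V}"
    using net_convergesE[OF x] by blast
  then show "\<exists>m\<in>D. \<forall>n\<in>D. (m, n) \<in> r \<longrightarrow> f (x n) \<in> V"
    by blast
qed

lemma net_converges_prod_topology:
  assumes x: "net_converges X D r x a" and y: "net_converges Y E s y b"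
  shows "net_converges (prod_topology X Y) (D \<times> E) (prod_order r s) (\<lambda>(n, m). (x n, y m)) (a, b)"
proof (rule net_convergesI)
  show "(a, b) \<in> topspace (prod_topology X Y)"
    using x y by (simp add: net_converges_def)
  fix W assume "W \<in> open_nhds (prod_topology X Y) (a, b)"
  then obtain A B where A: "A \<in> open_nhds X a" and B: "B \<in> open_nhds Y b" and "A \<times> B \<subseteq> W"
    by (rule open_nhds_prod_topologyE)
  moreover obtain n\<^sub>0 where "n\<^sub>0 \<in> D" "\<And>n. n \<in> D \<Longrightarrow> (n\<^sub>0, n) \<in> r \<Longrightarrow> x n \<in> A"
    using net_convergesE[OF x A] by blast
  moreover obtain m\<^sub>0 where "m\<^sub>0 \<in> E" "\<And>m. m \<in> E \<Longrightarrow> (m\<^sub>0, m) \<in> s \<Longrightarrow> y m \<in> B"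
    using net_convergesE[OF y B] by blast
  ultimately show "\<exists>p\<in>D \<times> E. \<forall>q\<in>D \<times> E. (p, q) \<in> prod_order r s \<longrightarrow>
      (case q of (n, m) \<Rightarrow> (x n, y m)) \<in> W"
    by (intro bexI[of _ "(n\<^sub>0, m\<^sub>0)"]) (auto simp: prod_order_def)
qed

lemma equicontinuous_at_imp_unif_net_converges:
  assumes f: "equicontinuous_at X \<U> f l" and x: "net_converges X D r x l" and "f l \<in> Z"
  shows "unif_net_converges Z \<U> D r (\<lambda>n. f (x n)) (f l)"
  unfolding unif_net_converges_def
proof (intro conjI ballI)
  fix U assume "U \<in> \<U>"
  then obtain V where "V \<in> open_nhds X l" and V: "f ` V \<subseteq> U `` {f l}"
    using f by (auto simp: equicontinuous_at_def open_nhds_def)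
  then obtain m where "m \<in> D" "\<And>n. n \<in> D \<Longrightarrow> (m, n) \<in> r \<Longrightarrow> x n \<in> V"
    using net_convergesE[OF x] by blast
  then show "\<exists>m\<in>D. \<forall>n\<in>D. (m, n) \<in> r \<longrightarrow> (f l, f (x n)) \<in> U"
    using V by blast
qed (fact assms(3))

lemma unif_net_converges_diagonal:
  assumes D: "directed_set D r"
    and z: "unif_net_converges Z \<U> (D \<times> D) (prod_order r r) (\<lambda>(n, m). z n m) l"
  shows "unif_net_converges Z \<U> D r (\<lambda>n. z n n) l"
  unfolding unif_net_converges_def
proof (intro conjI ballI)
  show "l \<in> Z"
    using z by (simp add: unif_net_converges_def)
  fix U assume "U \<in> \<U>"
  then obtain a b where ab: "a \<in> D" "b \<in> D"
    and "\<forall>n\<in>D. \<forall>m\<in>D. (a, n) \<in> r \<longrightarrow> (b, m) \<in> r \<longrightarrow> (l, z n m) \<in> U"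
    using z unfolding unif_net_converges_def prod_order_def by fastforce
  moreover obtain d where "d \<in> D" "(a, d) \<in> r" "(b, d) \<in> r"
    using D ab unfolding directed_set_def by blast
  moreover have "trans r"
    using D by (simp add: directed_set_def preorder_on_def)
  ultimately show "\<exists>m\<in>D. \<forall>n\<in>D. (m, n) \<in> r \<longrightarrow> (l, z n n) \<in> U"
    by (meson transD)
qed

lemma net_converges_box_selection:
  assumes "a \<in> topspace X" and "b \<in> topspace Y"
    and "\<And>d. d \<in> open_nhds X a \<times> open_nhds Y b \<Longrightarrow> p d \<in> fst d \<times> snd d"
  shows "net_converges (prod_topology X Y) (open_nhds X a \<times> open_nhds Y b)
    (prod_order (nhds_order X a) (nhds_order Y b)) p (a, b)"
proof (rule net_converges_nhds_base_selection)
  show "\<exists>d\<in>open_nhds X a \<times> open_nhds Y b. fst d \<times> snd d \<subseteq> W"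
    if W: "W \<in> open_nhds (prod_topology X Y) (a, b)" for W
  proof -
    obtain A B where "A \<in> open_nhds X a" "B \<in> open_nhds Y b" "A \<times> B \<subseteq> W"
      using W by (rule open_nhds_prod_topologyE)
    then show ?thesis
      by (intro bexI[of _ "(A, B)"]) simp_all
  qed
  show "fst e \<times> snd e \<subseteq> fst d \<times> snd d"
    if "(d, e) \<in> prod_order (nhds_order X a) (nhds_order Y b)" for d e
    using that by (auto simp: prod_order_def nhds_order_def)
qed (use assms in auto)

lemma equicontinuous_at_prod_topology_if_nets:
  fixes X :: "'x topology" and Y :: "'y topology"
  assumes a: "a \<in> topspace X" and b: "b \<in> topspace Y"
    and nets: "\<And>(D :: ('x set \<times> 'y set) set) r p.
      \<lbrakk>net_in D r p (topspace X \<times> topspace Y); net_converges (prod_topology X Y) D r p (a, b)\<rbrakk> \<Longrightarrow>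
      unif_net_converges Z \<U> D r (\<lambda>n. f (p n)) (f (a, b))"
  shows "equicontinuous_at (prod_topology X Y) \<U> f (a, b)"
proof (rule ccontr)
  define D where "D = open_nhds X a \<times> open_nhds Y b"
  define r where "r = prod_order (nhds_order X a) (nhds_order Y b)"
  assume "\<not> ?thesis"
  then obtain U where U: "U \<in> \<U>"
    and escapes: "\<And>V. V \<in> open_nhds (prod_topology X Y) (a, b) \<Longrightarrow> \<not> f ` V \<subseteq> U `` {f (a, b)}"
    by (auto simp: equicontinuous_at_def open_nhds_def)
  have "\<exists>q. q \<in> fst d \<times> snd d \<and> (f (a, b), f q) \<notin> U" if "d \<in> D" for d
  proof -
    have "fst d \<times> snd d \<in> open_nhds (prod_topology X Y) (a, b)"
      using that by (auto simp: D_def intro: Times_in_open_nhds)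
    from escapes[OF this] show ?thesis
      by blast
  qed
  then obtain p where p: "\<And>d. d \<in> D \<Longrightarrow> p d \<in> fst d \<times> snd d"
    and outside: "\<And>d. d \<in> D \<Longrightarrow> (f (a, b), f (p d)) \<notin> U"
    by metis
  have D: "directed_set D r"
    unfolding D_def r_def using a b by (intro directed_set_Times directed_set_open_nhds)
  have "net_converges (prod_topology X Y) D r p (a, b)"
    using a b p unfolding D_def r_def by (rule net_converges_box_selection)
  moreover have "fst d \<times> snd d \<subseteq> topspace X \<times> topspace Y" if "d \<in> D" for d
    using that by (intro Sigma_mono openin_subset) (auto simp: D_def open_nhds_def)
  then have "p \<in> D \<rightarrow> topspace X \<times> topspace Y"
    using p by blast
  ultimately have "unif_net_converges Z \<U> D r (\<lambda>n. f (p n)) (f (a, b))"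
    using D by (intro nets) (simp_all add: net_in_def)
  then obtain m where "m \<in> D" and tail: "\<And>n. n \<in> D \<Longrightarrow> (m, n) \<in> r \<Longrightarrow> (f (a, b), f (p n)) \<in> U"
    using U unfolding unif_net_converges_def by blast
  moreover have "(m, m) \<in> r"
    using D \<open>m \<in> D\<close> by (simp add: directed_set_def preorder_on_def refl_on_def)
  ultimately show False
    using outside by blast
qed

lemma equicontinuous_at_prod_topology_if_double_nets:
  fixes X :: "'x topology" and Y :: "'y topology"
  assumes "a \<in> topspace X" and "b \<in> topspace Y"
    and double_nets: "\<And>(D :: ('x set \<times> 'y set) set) r x y.
      \<lbrakk>net_in D r x (topspace X); net_converges X D r x a;
       net_in D r y (topspace Y); net_converges Y D r y b\<rbrakk> \<Longrightarrow>
      unif_net_converges Z \<U> (D \<times> D) (prod_order r r) (\<lambda>(n, m). f (x n, y m)) (f (a, b))"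
  shows "equicontinuous_at (prod_topology X Y) \<U> f (a, b)"
proof (rule equicontinuous_at_prod_topology_if_nets[OF assms(1,2)])
  fix D :: "('x set \<times> 'y set) set" and r p
  assume p: "net_in D r p (topspace X \<times> topspace Y)"
    and p_conv: "net_converges (prod_topology X Y) D r p (a, b)"
  have D: "directed_set D r"
    using p by (simp add: net_in_def)
  have fst_p: "net_in D r (\<lambda>n. fst (p n)) (topspace X)"
    and snd_p: "net_in D r (\<lambda>n. snd (p n)) (topspace Y)"
    using p by (simp_all add: net_in_def Pi_iff mem_Times_iff)
  have fst_conv: "net_converges X D r (\<lambda>n. fst (p n)) a"
    using net_converges_continuous_map[OF continuous_map_fst p_conv] by simp
  have snd_conv: "net_converges Y D r (\<lambda>n. snd (p n)) b"
    using net_converges_continuous_map[OF continuous_map_snd p_conv] by simp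
  show "unif_net_converges Z \<U> D r (\<lambda>n. f (p n)) (f (a, b))"
    using unif_net_converges_diagonal[OF D double_nets[OF fst_p fst_conv snd_p snd_conv]] by simp
qed

lemma admissible_iff_equicontinuous_at:
  assumes "topspace T = EC Y Z \<U>"
  shows "admissible Y Z \<U> T \<longleftrightarrow> (\<forall>f\<in>EC Y Z \<U>. \<forall>y\<in>topspace Y.
    equicontinuous_at (prod_topology T Y) \<U> (\<lambda>(f, y). f y) (f, y))"
proof -
  have "(\<lambda>(f, y). f y) \<in> EC Y Z \<U> \<times> topspace Y \<rightarrow> Z"
    by (auto simp: EC_def)
  then show ?thesis
    using assms by (auto simp: admissible_def equicontinuous_def)
qed

lemma admissible_imp_equicont_converges:
  assumes T: "topspace T = EC Y Z \<U>" and adm: "admissible Y Z \<U> T"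
    and F: "net_converges T D r F f"
  shows "equicont_converges TYPE('s) Y Z \<U> D r F f"
  unfolding equicont_converges_def
proof (intro allI impI)
  fix S :: "'s set" and s y l
  assume "net_in S s y (topspace Y) \<and> net_converges Y S s y l"
  then have y: "net_converges Y S s y l" ..
  have f: "f \<in> EC Y Z \<U>" and l: "l \<in> topspace Y"
    using F y T by (auto simp: net_converges_def)
  have "equicontinuous_at (prod_topology T Y) \<U> (\<lambda>(f, y). f y) (f, l)"
    using adm f l by (simp add: admissible_iff_equicontinuous_at[OF T])
  moreover have "f l \<in> Z"
    using f l by (auto simp: EC_def)
  ultimately show
    "unif_net_converges Z \<U> (D \<times> S) (prod_order r s) (\<lambda>(n, m). F n (y m)) (f l)"
    using equicontinuous_at_imp_unif_net_converges[OF _ net_converges_prod_topology[OF F y]]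
    by (fastforce simp: case_prod_unfold)
qed

lemma equicont_converges_imp_admissible:
  fixes Y :: "'y topology" and T :: "('y \<Rightarrow> 'z) topology"
  assumes T: "topspace T = EC Y Z \<U>"
    and equicont: "\<And>(D :: (('y \<Rightarrow> 'z) set \<times> 'y set) set) r F f.
      \<lbrakk>f \<in> EC Y Z \<U>; net_in D r F (EC Y Z \<U>); net_converges T D r F f\<rbrakk> \<Longrightarrow>
      equicont_converges TYPE(('y \<Rightarrow> 'z) set \<times> 'y set) Y Z \<U> D r F f"
  shows "admissible Y Z \<U> T"
  unfolding admissible_iff_equicontinuous_at[OF T]
proof (intro ballI equicontinuous_at_prod_topology_if_double_nets)
  fix f y and D :: "(('y \<Rightarrow> 'z) set \<times> 'y set) set" and r F x
  assume f: "f \<in> EC Y Z \<U>" and "y \<in> topspace Y"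
    and F: "net_in D r F (topspace T)" "net_converges T D r F f"
    and x: "net_in D r x (topspace Y)" "net_converges Y D r x y"
  have "equicont_converges TYPE(('y \<Rightarrow> 'z) set \<times> 'y set) Y Z \<U> D r F f"
    using f F by (intro equicont) (simp_all add: T)
  then show "unif_net_converges Z \<U> (D \<times> D) (prod_order r r)
      (\<lambda>(n, m). case (F n, x m) of (f, y) \<Rightarrow> f y) (case (f, y) of (f, y) \<Rightarrow> f y)"
    using x by (simp add: equicont_converges_def)
qed (simp_all add: T)

(* HOL cannot quantify over types inside a formula. The index type in the first conjunct is the one
   the converse needs; 'd and 's in the second stand for index sets of arbitrary types. *)
theorem theorem4p8:
  fixes Y :: "'y topology" and Z :: "'z set" and \<U> :: "('z \<times> 'z) set set"
    and T :: "('y \<Rightarrow> 'z) topology"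
  assumes "entourage_family Z \<U>"
    and "topspace T = EC Y Z \<U>"
  shows "(admissible Y Z \<U> T \<longleftrightarrow>
            (\<forall>(D :: (('y \<Rightarrow> 'z) set \<times> 'y set) set) r F. \<forall>f \<in> EC Y Z \<U>.
               net_in D r F (EC Y Z \<U>) \<longrightarrow> net_converges T D r F f \<longrightarrow>
               equicont_converges TYPE(('y \<Rightarrow> 'z) set \<times> 'y set) Y Z \<U> D r F f)) \<and>
         (admissible Y Z \<U> T \<longrightarrow>
            (\<forall>(D :: 'd set) r F. \<forall>f \<in> EC Y Z \<U>.
               net_in D r F (EC Y Z \<U>) \<longrightarrow> net_converges T D r F f \<longrightarrow>
               equicont_converges TYPE('s) Y Z \<U> D r F f))"
proof (intro conjI iffI allI ballI impI)
  assume "\<forall>(D :: (('y \<Rightarrow> 'z) set \<times> 'y set) set) r F. \<forall>f \<in> EC Y Z \<U>.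
    net_in D r F (EC Y Z \<U>) \<longrightarrow> net_converges T D r F f \<longrightarrow>
    equicont_converges TYPE(('y \<Rightarrow> 'z) set \<times> 'y set) Y Z \<U> D r F f"
  then show "admissible Y Z \<U> T"
    by (intro equicont_converges_imp_admissible[OF assms(2)]) simp
qed (rule admissible_imp_equicont_converges[OF assms(2)]; assumption)+

end
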